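(* Let $S\subseteq\mathbb{Z}_2^n$ have a basis $B$ with dependent set $D=S\setminus B=\{x_1,x_2,\dots,x_r\}$, where $r\ge 2$ and the $x_i$ are distinct. For each $i$ let $B_i\subseteq B$ be the unique subset of $B$ whose elements sum to $x_i$. Suppose there exists $a\in (B_1\cap B_2)\setminus\bigcup_{i=3}^r B_i$. Let $B'=(B\setminus\{a\})\cup\{x_2\}$ and $D'=(D\setminus\{x_2\})\cup\{a\}$. Then: (1) $B'$ is a basis for $S$ with dependent set $D'$; (2) the subset $B'_1$ of $B'$ summing to $x_1$ is $(B_1\mathbin{\triangle} B_2)\cup\{x_2\}$, where $\triangle$ is symmetric difference; (3) the subset $B'_a$ of $B'$ summing to $a$ is $(B_2\setminus\{a\})\cup\{x_2\}$; (4) for $i>2$, the subset $B'_i$ of $B'$ summing to $x_i$ equals $B_i$.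
   Context: In $\mathbb{Z}_2^n$, an affine combination of a set is a sum of an odd number of its distinct elements. A set is affinely independent if no element is an affine combination of the others, and $\operatorname{aff}(S)$ denotes the set of all affine combinations of elements of $S$. A basis for $S$ is an affinely independent subset $B\subseteq S$ with $\operatorname{aff}(B)=\operatorname{aff}(S)$; its dependent set is $S\setminus B$. Each element of the dependent set is the sum of a unique subset of $B$. *)

theory Defs
  imports "HOL-Analysis.Finite_Cartesian_Product" "HOL-Library.Z2"
begin

instance bit :: finite
proof
  have "(UNIV :: bit set) = {0, 1}" using bit_not_one_iff by auto
  then show "finite (UNIV :: bit set)" by (metis finite.emptyI finite.insertI)
qed

definition aff :: "(bit ^ 'n) set \<Rightarrow> (bit ^ 'n) set" where
  "aff S = {\<Sum>C | C. C \<subseteq> S \<and> odd (card C)}"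

definition affinely_independent :: "(bit ^ 'n) set \<Rightarrow> bool" where
  "affinely_independent S \<longleftrightarrow> (\<forall>x\<in>S. x \<notin> aff (S - {x}))"

definition is_basis :: "(bit ^ 'n) set \<Rightarrow> (bit ^ 'n) set \<Rightarrow> bool" where
  "is_basis B S \<longleftrightarrow> B \<subseteq> S \<and> affinely_independent B \<and> aff B = aff S"

text \<open>\<open>C\<close> is the unique subset of \<open>B\<close> expressing \<open>x\<close> as an affine combination.
  The parity condition is needed for uniqueness: in the affinely independent set
  \<open>{0, u, v}\<close>, both \<open>{u, v}\<close> and \<open>{0, u, v}\<close> sum to \<open>u + v\<close>.\<close>

definition is_unique_subset :: "(bit ^ 'n) set \<Rightarrow> bit ^ 'n \<Rightarrow> (bit ^ 'n) set \<Rightarrow> bool" where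
  "is_unique_subset B x C \<longleftrightarrow>
     (C \<subseteq> B \<and> odd (card C) \<and> \<Sum>C = x) \<and>
     (\<forall>C'. C' \<subseteq> B \<and> odd (card C') \<and> \<Sum>C' = x \<longrightarrow> C' = C)"

lemma bit_vec_add_self: "x + x = (0 :: bit ^ 'n)"
  by (simp add: vec_eq_iff)

lemma sum_sym_diff_bit:
  fixes C D :: "(bit ^ 'n) set"
  shows "\<Sum>(sym_diff C D) = \<Sum>C + \<Sum>D"
proof -
  have C: "\<Sum>C = \<Sum>(C - D) + \<Sum>(C \<inter> D)"
    by (subst sum.Int_Diff[of C _ D]) (simp_all add: add.commute)
  have D: "\<Sum>D = \<Sum>(D - C) + \<Sum>(C \<inter> D)"
    by (subst sum.Int_Diff[of D _ C]) (simp_all add: add.commute Int_commute)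
  have "\<Sum>C + \<Sum>D = \<Sum>(C - D) + \<Sum>(D - C) + (\<Sum>(C \<inter> D) + \<Sum>(C \<inter> D))"
    by (simp only: C D ac_simps)
  also have "\<dots> = \<Sum>(C - D) + \<Sum>(D - C)"
    by (simp only: bit_vec_add_self add_0_right)
  also have "\<dots> = \<Sum>(sym_diff C D)"
    by (subst sum.union_disjoint[symmetric]) auto
  finally show ?thesis by simp
qed

lemma even_card_sym_diff:
  fixes C D :: "(bit ^ 'n) set"
  assumes "odd (card C)" "odd (card D)"
  shows "even (card (sym_diff C D))"
proof -
  have "card C = card (C - D) + card (C \<inter> D)"
    by (subst card_Int_Diff[of C D]) simp_all
  moreover have "card D = card (D - C) + card (C \<inter> D)"
    by (subst card_Int_Diff[of D C]) (simp_all add: Int_commute)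
  moreover have "card (sym_diff C D) = card (C - D) + card (D - C)"
    by (subst card_Un_disjoint[symmetric]) auto
  ultimately show ?thesis using assms by simp
qed

lemma ex_unique_subset:
  assumes "is_basis B S" and "x \<in> S"
  shows "\<exists>!C. is_unique_subset B x C"
proof -
  have "x = \<Sum>{x} \<and> {x} \<subseteq> S \<and> odd (card {x})" using assms by simp
  then have "x \<in> aff S" unfolding aff_def by blast
  then have "x \<in> aff B" using assms by (simp add: is_basis_def)
  then obtain C where C: "C \<subseteq> B" "odd (card C)" "\<Sum>C = x"
    unfolding aff_def by blast
  have "C' = C" if C': "C' \<subseteq> B" "odd (card C')" "\<Sum>C' = x" for C'
  proof (rule ccontr)
    let ?E = "sym_diff C C'"
    assume "C' \<noteq> C"
    then obtain y where y: "y \<in> ?E" by blast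
    have "\<Sum>?E = 0"
      using C C' by (simp only: sum_sym_diff_bit bit_vec_add_self)
    then have "y + \<Sum>(?E - {y}) = 0"
      using y by (metis finite sum.remove)
    then have "y = \<Sum>(?E - {y})"
      by (metis bit_vec_add_self add_left_cancel)
    moreover have "odd (card (?E - {y}))"
      using even_card_sym_diff[OF C(2) C'(2)] y card_Suc_Diff1[OF _ y]
      by (metis finite even_Suc)
    moreover have "?E - {y} \<subseteq> B - {y}" using C C' by blast
    ultimately have "y \<in> aff (B - {y})" unfolding aff_def by blast
    moreover have "y \<in> B" using y C C' by blast
    ultimately show False
      using assms by (auto simp: is_basis_def affinely_independent_def)
  qed
  with C show ?thesis unfolding is_unique_subset_def by blast
qed

end

theory Submission imports Defs begin

text \<open>
  Since \<open>x\<^sub>2 = \<Sum>B\<^sub>2\<close> with \<open>|B\<^sub>2|\<close> odd, the circuit \<open>Z = B\<^sub>2 \<union> {x\<^sub>2}\<close> has even size and sum zero.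
  Taking the symmetric difference with \<open>Z\<close> therefore preserves both the sum and the parity of a
  subset of \<open>B \<union> {x\<^sub>2}\<close>, and it toggles membership of both \<open>a\<close> and \<open>x\<^sub>2\<close>. This translates
  between subsets of \<open>B\<close> and subsets of \<open>B' = (B - {a}) \<union> {x\<^sub>2}\<close> and gives the exchange of \<open>a\<close>
  for \<open>x\<^sub>2\<close>; the new representations are then forced by uniqueness.
\<close>

text \<open>The intersection is counted twice. \<open>even_card_sym_diff\<close> covers only two odd
  sets, while here one set is an even circuit and the other has either parity.\<close>

lemma even_card_sym_diff_iff:
  fixes C D :: "(bit ^ 'n) set"
  shows "even (card (sym_diff C D)) \<longleftrightarrow> even (card C + card D)"
proof -
  have "card C = card (C - D) + card (C \<inter> D)"
    by (subst card_Int_Diff[of C D]) simp_all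
  moreover have "card D = card (D - C) + card (C \<inter> D)"
    by (subst card_Int_Diff[of D C]) (simp_all add: Int_commute)
  moreover have "card (sym_diff C D) = card (C - D) + card (D - C)"
    by (subst card_Un_disjoint[symmetric]) auto
  ultimately show ?thesis by (simp, blast)
qed

lemma bit_vec_add_eq_0_iff: "x + y = 0 \<longleftrightarrow> x = (y :: bit ^ 'n)"
  by (metis add_left_cancel bit_vec_add_self)

text \<open>In characteristic 2, a relation \<open>y = \<Sum>C\<close> with \<open>C\<close> odd and
  \<open>y \<notin> C\<close> is the same as the even zero-sum set \<open>insert y C\<close>, in
  which no element is singled out. This form is stable under symmetric difference with a
  circuit.\<close>

lemma affinely_independent_iff:
  fixes B :: "(bit ^ 'n) set"
  shows "affinely_independent B \<longleftrightarrow> (\<forall>E \<subseteq> B. even (card E) \<and> \<Sum>E = 0 \<longrightarrow> E = {})"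
proof
  assume ind: "affinely_independent B"
  show "\<forall>E \<subseteq> B. even (card E) \<and> \<Sum>E = 0 \<longrightarrow> E = {}"
  proof (intro allI impI, rule ccontr)
    fix E assume E: "E \<subseteq> B" "even (card E) \<and> \<Sum>E = 0" and "E \<noteq> {}"
    then obtain y where y: "y \<in> E" by blast
    have "y + \<Sum>(E - {y}) = 0"
      using E y sum.remove[OF finite y, of "\<lambda>z. z"] by simp
    then have "y = \<Sum>(E - {y})"
      by (simp only: bit_vec_add_eq_0_iff)
    moreover have "odd (card (E - {y}))"
      using E card_Suc_Diff1[OF finite y] by (metis even_Suc)
    moreover have "E - {y} \<subseteq> B - {y}" using E by blast
    ultimately have "y \<in> aff (B - {y})" unfolding aff_def by blast
    with ind E y show False unfolding affinely_independent_def by blast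
  qed
next
  assume triv: "\<forall>E \<subseteq> B. even (card E) \<and> \<Sum>E = 0 \<longrightarrow> E = {}"
  show "affinely_independent B"
    unfolding affinely_independent_def
  proof (intro ballI notI)
    fix y assume y: "y \<in> B" "y \<in> aff (B - {y})"
    then obtain C where C: "C \<subseteq> B - {y}" "odd (card C)" "y = \<Sum>C"
      unfolding aff_def by blast
    have "y \<notin> C" using C by blast
    then have "even (card (insert y C))" using C by simp
    moreover have "\<Sum>(insert y C) = 0"
      using \<open>y \<notin> C\<close> C(3) by (metis bit_vec_add_self finite sum.insert)
    ultimately show False using triv y C by blast
  qed
qed

lemma aff_mono: "A \<subseteq> B \<Longrightarrow> aff A \<subseteq> aff B"
  unfolding aff_def by blast

text \<open>Uniqueness is inherited from \<open>ex_unique_subset\<close>, so for a known basis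
  exhibiting one odd representation suffices.\<close>

lemma is_unique_subsetI:
  assumes "is_basis B S" "x \<in> S" "C \<subseteq> B" "odd (card C)" "\<Sum>C = x"
  shows "is_unique_subset B x C"
  using ex_unique_subset[OF assms(1,2)] assms(3-5)
  unfolding is_unique_subset_def by metis

lemma basis_exchange:
  assumes basis: "is_basis B S" and x: "x \<in> S" "x \<notin> B"
    and C: "C \<subseteq> B" "odd (card C)" "\<Sum>C = x" and a: "a \<in> C"
  shows "is_basis (insert x (B - {a})) S"
proof -
  let ?B' = "insert x (B - {a})" and ?Z = "insert x C"
  have xC: "x \<notin> C" using x C by blast
  have Z: "even (card ?Z)" "\<Sum>?Z = 0"
    using C xC by (simp, metis bit_vec_add_self finite sum.insert)
  have sum_Z: "\<Sum>(sym_diff E ?Z) = \<Sum>E" for E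
    using sum_sym_diff_bit[of E ?Z] by (simp only: Z add_0_right)
  have parity_Z: "even (card (sym_diff E ?Z)) \<longleftrightarrow> even (card E)" for E
    using Z even_card_sym_diff_iff[of E ?Z] by simp
  have sub: "?B' \<subseteq> S"
    using basis x by (auto simp: is_basis_def)
  \<comment> \<open>The other inclusion follows from \<open>?B' \<subseteq> S\<close> by
    monotonicity.\<close>
  have "aff B \<subseteq> aff ?B'"
  proof
    fix y assume "y \<in> aff B"
    then obtain E where E: "E \<subseteq> B" "odd (card E)" "y = \<Sum>E"
      unfolding aff_def by blast
    show "y \<in> aff ?B'"
    proof (cases "a \<in> E")
      case False
      then have "E \<subseteq> ?B'" using E by blast
      with E show ?thesis unfolding aff_def by blast
    next
      case True
      \<comment> \<open>Both \<open>E\<close> and \<open>?Z\<close> contain \<open>a\<close>, so it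
        cancels and \<open>x\<close> takes its place.\<close>
      then have "sym_diff E ?Z \<subseteq> ?B'" using E C a by blast
      moreover have "odd (card (sym_diff E ?Z))" using E parity_Z by blast
      moreover have "y = \<Sum>(sym_diff E ?Z)" using E sum_Z by simp
      ultimately show ?thesis unfolding aff_def by blast
    qed
  qed
  then have "aff ?B' = aff S"
    using basis aff_mono[OF sub] by (simp add: is_basis_def)
  moreover have "affinely_independent ?B'"
    unfolding affinely_independent_iff
  proof (intro allI impI)
    fix E assume E: "E \<subseteq> ?B'" "even (card E) \<and> \<Sum>E = 0"
    have triv: "F = {}" if "F \<subseteq> B" "even (card F)" "\<Sum>F = 0" for F
      using basis that by (auto simp: is_basis_def affinely_independent_iff)
    show "E = {}"
    proof (cases "x \<in> E")
      case False
      with E triv show ?thesis by blast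
    next
      case True
      \<comment> \<open>This case is contradictory: adding \<open>?Z\<close> cancels
        \<open>x\<close>, leaving an even zero-sum subset of \<open>B\<close>, hence the empty set;
        yet \<open>a\<close> lies in \<open>?Z\<close> but not in \<open>E\<close>, so it
        survives.\<close>
      have "a \<notin> E" using E a C x by blast
      then have "a \<in> sym_diff E ?Z" using a by blast
      moreover have "sym_diff E ?Z = {}"
      proof (rule triv)
        show "sym_diff E ?Z \<subseteq> B" using True E C by blast
        show "even (card (sym_diff E ?Z))" using E parity_Z by blast
        show "\<Sum>(sym_diff E ?Z) = 0" using E by (simp only: sum_Z)
      qed
      ultimately show ?thesis by blast
    qed
  qed
  ultimately show ?thesis using sub by (simp add: is_basis_def)
qed

theorem theorem2p15:
  fixes S B D B' D' :: "(bit ^ 'n) set"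
    and x :: "nat \<Rightarrow> bit ^ 'n"
    and Bs :: "nat \<Rightarrow> (bit ^ 'n) set"
    and r :: nat
    and a :: "bit ^ 'n"
  assumes "is_basis B S"
    and "D = S - B"
    and "D = x ` {1..r}"
    and "inj_on x {1..r}"
    and "r \<ge> 2"
    and "\<And>i. i \<in> {1..r} \<Longrightarrow> is_unique_subset B (x i) (Bs i)"
    and "a \<in> (Bs 1 \<inter> Bs 2) - (\<Union>i\<in>{3..r}. Bs i)"
    and "B' = (B - {a}) \<union> {x 2}"
    and "D' = (D - {x 2}) \<union> {a}"
  shows "(is_basis B' S \<and> S - B' = D')
    \<and> is_unique_subset B' (x 1) (sym_diff (Bs 1) (Bs 2) \<union> {x 2})
    \<and> is_unique_subset B' a ((Bs 2 - {a}) \<union> {x 2})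
    \<and> (\<forall>i\<in>{3..r}. is_unique_subset B' (x i) (Bs i))"
proof -
  have xS: "x i \<in> S" "x i \<notin> B" if "i \<in> {1..r}" for i
    using assms(2,3) that by blast+
  have Bs: "Bs i \<subseteq> B" "odd (card (Bs i))" "\<Sum>(Bs i) = x i" if "i \<in> {1..r}" for i
    using assms(6)[OF that] by (auto simp: is_unique_subset_def)
  have r: "1 \<in> {1..r}" "2 \<in> {1..r}" using assms(5) by auto
  have a: "a \<in> Bs 1" "a \<in> Bs 2" "a \<in> B" "a \<in> S"
    using assms(1,7) Bs(1)[OF r(1)] by (auto simp: is_basis_def)
  have x2: "x 2 \<notin> Bs 1" "x 2 \<notin> Bs 2"
    using xS(2)[OF r(2)] Bs(1)[OF r(1)] Bs(1)[OF r(2)] by blast+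
  have B': "B' = insert (x 2) (B - {a})" using assms(8) by simp
  have basis': "is_basis B' S"
    unfolding B' using basis_exchange[OF assms(1) xS[OF r(2)] Bs[OF r(2)] a(2)] .
  have "S - B' = D'"
    using assms(2,8,9) xS[OF r(2)] a by blast
  moreover have "is_unique_subset B' (x 1) (sym_diff (Bs 1) (Bs 2) \<union> {x 2})"
  proof (rule is_unique_subsetI[OF basis' xS(1)[OF r(1)]])
    \<comment> \<open>Membership of \<open>a\<close> in both \<open>Bs 1\<close> and
      \<open>Bs 2\<close> removes it from the symmetric difference.\<close>
    show "sym_diff (Bs 1) (Bs 2) \<union> {x 2} \<subseteq> B'"
      using Bs(1)[OF r(1)] Bs(1)[OF r(2)] a B' by blast
    have notin: "x 2 \<notin> sym_diff (Bs 1) (Bs 2)" using x2 by blast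
    then show "odd (card (sym_diff (Bs 1) (Bs 2) \<union> {x 2}))"
      using even_card_sym_diff[OF Bs(2)[OF r(1)] Bs(2)[OF r(2)]] by simp
    have "\<Sum>(sym_diff (Bs 1) (Bs 2) \<union> {x 2}) = x 2 + \<Sum>(sym_diff (Bs 1) (Bs 2))"
      using notin by simp
    also have "\<dots> = x 1 + (x 2 + x 2)"
      by (simp only: sum_sym_diff_bit Bs(3)[OF r(1)] Bs(3)[OF r(2)] ac_simps)
    finally show "\<Sum>(sym_diff (Bs 1) (Bs 2) \<union> {x 2}) = x 1"
      by (simp only: bit_vec_add_self add_0_right)
  qed
  moreover have "is_unique_subset B' a ((Bs 2 - {a}) \<union> {x 2})"
  proof (rule is_unique_subsetI[OF basis' a(4)])
    show "(Bs 2 - {a}) \<union> {x 2} \<subseteq> B'"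
      using Bs(1)[OF r(2)] B' by blast
    have notin: "x 2 \<notin> Bs 2 - {a}" using x2 by blast
    then have "card ((Bs 2 - {a}) \<union> {x 2}) = card (Bs 2)"
      using card_Suc_Diff1[OF finite a(2)] by simp
    then show "odd (card ((Bs 2 - {a}) \<union> {x 2}))"
      using Bs(2)[OF r(2)] by simp
    \<comment> \<open>Adding \<open>\<Sum>(Bs 2 - {a})\<close> to both sides solves this for
      \<open>a\<close>.\<close>
    have "x 2 = a + \<Sum>(Bs 2 - {a})"
      using Bs(3)[OF r(2)] sum.remove[OF finite a(2), of "\<lambda>z. z"] by simp
    moreover have "\<Sum>((Bs 2 - {a}) \<union> {x 2}) = x 2 + \<Sum>(Bs 2 - {a})"
      using notin by simp
    ultimately show "\<Sum>((Bs 2 - {a}) \<union> {x 2}) = a"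
      by (metis add.assoc add_0_right bit_vec_add_self)
  qed
  moreover have "is_unique_subset B' (x i) (Bs i)" if i: "i \<in> {3..r}" for i
  proof -
    have i': "i \<in> {1..r}" using i by simp
    \<comment> \<open>Since \<open>a\<close> avoids \<open>Bs i\<close> for
      \<open>i \<ge> 3\<close>, the old representation survives the exchange.\<close>
    have "Bs i \<subseteq> B'" using Bs(1)[OF i'] assms(7) i B' by blast
    then show ?thesis
      using is_unique_subsetI[OF basis' xS(1)[OF i']] Bs[OF i'] by blast
  qed
  ultimately show ?thesis using basis' by blast
qed

end
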